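(* Let $V$ be a three-dimensional real vector space with a rotation group $D\subset\operatorname{GL}(V)$, whose elements are called rotations. Let $v,w\in V$ be orthogonal in the sense that there is a rotation that fixes one of them and maps the other to its negative. Let $n\in V$, $n\neq 0$, and let $a,b,c\in\mathbb{R}$ be such that $v$, $w$ and $v+w$ are mapped by (possibly different) rotations in $D$ to $an$, $bn$ and $cn$, respectively. Then $$a^2+b^2=c^2.$$
   Context: A ray in a real vector space $V$ is a subset $L\subset V$ of the form $L=\mathbb{R}_{\geq 0}v$ for some $v\neq 0$. A half-plane in $V$ is a subset $H\subset V$ of the form $H=\mathbb{R}v+\mathbb{R}_{\geq 0}w$ for some linearly independent $v,w\in V$; its boundary is the unique line (one-dimensional linear subspace) contained in it, namely $\mathbb{R}v$. A rotation group in a three-dimensional real vector space $V$ is a subgroup $D\subset\operatorname{GL}(V)$ such that for any two pairs $(H,L)$, $(H',L')$, each consisting of a half-plane and a ray contained in its boundary, there is exactly one $d\in D$ with $d(H)=H'$ and $d(L)=L'$. No topological condition on $D$ is assumed. *)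

theory Defs
  imports Complex_Main "HOL-Algebra.Group"
begin

definition ray :: "'a::real_vector set \<Rightarrow> bool" where
  "ray L \<longleftrightarrow> (\<exists>v. v \<noteq> 0 \<and> L = {t *\<^sub>R v | t. t \<ge> 0})"

definition half_plane :: "'a::real_vector set \<Rightarrow> bool" where
  "half_plane H \<longleftrightarrow>
     (\<exists>v w. v \<noteq> w \<and> independent {v, w} \<and> H = {s *\<^sub>R v + t *\<^sub>R w | s t. t \<ge> 0})"

definition line :: "'a::real_vector set \<Rightarrow> bool" where
  "line l \<longleftrightarrow> subspace l \<and> dim l = 1"

definition boundary_line :: "'a::real_vector set \<Rightarrow> 'a set" where
  "boundary_line H = (THE l. line l \<and> l \<subseteq> H)"

definition GL :: "('a::real_vector \<Rightarrow> 'a) monoid" where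
  "GL = \<lparr>carrier = {f. linear f \<and> bij f}, mult = (\<circ>), one = id\<rparr>"

definition rotation_group :: "('a::real_vector \<Rightarrow> 'a) set \<Rightarrow> bool" where
  "rotation_group D \<longleftrightarrow> subgroup D GL \<and>
     (\<forall>H L H' L'.
        half_plane H \<and> ray L \<and> L \<subseteq> boundary_line H \<and>
        half_plane H' \<and> ray L' \<and> L' \<subseteq> boundary_line H' \<longrightarrow>
        (\<exists>!d. d \<in> D \<and> d ` H = H' \<and> d ` L = L'))"

definition orthogonal_wrt :: "('a::real_vector \<Rightarrow> 'a) set \<Rightarrow> 'a \<Rightarrow> 'a \<Rightarrow> bool" where
  "orthogonal_wrt D v w \<longleftrightarrow> (\<exists>d\<in>D. (d v = v \<and> d w = - w) \<or> (d w = w \<and> d v = - v))"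

lemma line_iff_span: "line l \<longleftrightarrow> (\<exists>v. v \<noteq> 0 \<and> l = span {v})"
proof
  assume "line l"
  then have l: "subspace l" "dim l = 1" by (auto simp: line_def)
  obtain B where B: "B \<subseteq> l" "independent B" "l \<subseteq> span B" "card B = dim l"
    using real_vector.basis_exists by blast
  then obtain v where v: "B = {v}" using l by (auto simp: card_1_singleton_iff)
  have "span B \<subseteq> l" using B l by (intro real_vector.span_minimal)
  then show "\<exists>v. v \<noteq> 0 \<and> l = span {v}"
    using B v real_vector.dependent_zero[of B] by (intro exI[of _ v]) auto
next
  assume "\<exists>v. v \<noteq> 0 \<and> l = span {v}"
  then obtain v where v: "v \<noteq> 0" "l = span {v}" by blast
  then have "independent {v}" by simp
  then show "line l" using v real_vector.dim_span_eq_card_independent[of "{v}"]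
    by (simp add: line_def)
qed

lemma boundary_line_half_plane:
  fixes v w :: "'a::real_vector"
  assumes "v \<noteq> w" "independent {v, w}"
  shows "boundary_line {s *\<^sub>R v + t *\<^sub>R w | s t. t \<ge> 0} = span {v}"
proof -
  let ?H = "{s *\<^sub>R v + t *\<^sub>R w | s t. t \<ge> 0}"
  have v: "v \<noteq> 0" using assms(2) real_vector.dependent_zero[of "{v, w}"] by auto
  have w: "w \<notin> span {v}"
    using assms real_vector.independent_insert[of w "{v}"] by (simp add: insert_commute)
  have "span {v} \<subseteq> ?H"
    by (auto simp: real_vector.span_singleton) (metis add.right_neutral order_refl scaleR_zero_left)
  moreover have "l = span {v}" if l: "line l" "l \<subseteq> ?H" for l
  proof -
    obtain u where u: "u \<noteq> 0" "l = span {u}" using l line_iff_span by blast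
    then have "u \<in> l" "- u \<in> l"
      by (simp_all add: real_vector.span_base real_vector.span_neg)
    then have "u \<in> ?H" "- u \<in> ?H"
      using l(2) by blast+
    then obtain s t s' t' where st: "u = s *\<^sub>R v + t *\<^sub>R w" "t \<ge> 0"
      "- u = s' *\<^sub>R v + t' *\<^sub>R w" "t' \<ge> 0" by blast
    have "(s + s') *\<^sub>R v + (t + t') *\<^sub>R w = u + - u"
      unfolding st(3) by (subst st(1)) (simp add: algebra_simps)
    then have "(t + t') *\<^sub>R w = (- (s + s')) *\<^sub>R v"
      by (simp only: add.right_inverse) (metis add.commute add_eq_0_iff scaleR_minus_left)
    then have "(t + t') *\<^sub>R w \<in> span {v}"
      by (simp only: real_vector.span_singleton) blast
    then have "t + t' = 0"
      using w real_vector.span_scale[of "(t + t') *\<^sub>R w" "{v}" "inverse (t + t')"]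
      by (cases "t + t' = 0") simp_all
    then have us: "u = s *\<^sub>R v" using st by simp
    then have "s \<noteq> 0" using u by auto
    then have "v = inverse s *\<^sub>R u" using us by simp
    then have "u \<in> span {v}" "v \<in> span {u}"
      by (metis us real_vector.span_base real_vector.span_scale singletonI)+
    then show ?thesis
      unfolding u(2) by (simp add: real_vector.span_eq)
  qed
  ultimately show ?thesis
    unfolding boundary_line_def using v line_iff_span by (intro the_equality) blast+
qed

lemma group_GL: "group GL"
proof (rule groupI)
  fix f :: "'a \<Rightarrow> 'a" assume "f \<in> carrier GL"
  then have f: "linear f" "bij f" by (auto simp: GL_def)
  have "linear (inv_into UNIV f)"
    using f by (intro linearI inv_f_eq)
      (auto simp: bij_is_inj bij_is_surj surj_f_inv_f linear_add linear_scale)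
  moreover have "inv_into UNIV f \<circ> f = id"
    using f by (simp add: bij_is_inj)
  ultimately show "\<exists>y\<in>carrier GL. y \<otimes>\<^bsub>GL\<^esub> f = \<one>\<^bsub>GL\<^esub>"
    using f by (intro bexI[of _ "inv_into UNIV f"]) (auto simp: GL_def bij_imp_bij_inv)
qed (auto simp: GL_def o_assoc bij_comp linear_compose real_vector.linear_id)

end

theory Submission
  imports Defs
begin

text \<open>
  Simple transitivity on flags yields, for every \<open>v \<noteq> 0\<close>, a unique half-turn in \<open>D\<close> about \<open>v\<close>, of
  the form \<open>x \<mapsto> 2 \<phi>(v,x) v - x\<close> with \<open>\<phi>(v,-)\<close> linear. By uniqueness \<open>\<phi>\<close> is invariant under
  \<open>D\<close>, and this makes the relation \<open>\<phi>(v,w) = 0\<close> symmetric. In a suitable frame the polar plane of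
  \<open>(1,t,s)\<close> is \<open>x + f(t) y + g(s) z = 0\<close>, and symmetry of the polarity forces \<open>f = g\<close> to be a field
  automorphism of the reals, hence the identity (no continuity is needed). So \<open>\<phi>(v,w) = 0\<close> is
  orthogonality for an inner product, every rotation is a similarity for it, and composing with
  half-turns reduces the similarity ratio to that of a rotation scaling two axes by \<open>\<plusminus>s\<close>; its square
  fixes a flag, so \<open>s = 1\<close>. Thus rotations are isometries and Pythagoras' theorem applies.
\<close>

section \<open>Flags\<close>

text \<open>Independence of an ordered pair in coefficient form, ready for use on equations; unlike
  \<open>independent {v, w}\<close> it also excludes \<open>v = w\<close>.\<close>

definition li2 :: "'a::real_vector \<Rightarrow> 'a \<Rightarrow> bool" where
  "li2 v w \<longleftrightarrow> (\<forall>a b. a *\<^sub>R v + b *\<^sub>R w = 0 \<longrightarrow> a = 0 \<and> b = 0)"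

lemma li2I:
  assumes "v \<noteq> 0" "\<And>c. w \<noteq> c *\<^sub>R v"
  shows "li2 v w"
  unfolding li2_def
proof (intro allI impI)
  fix a b assume eq: "a *\<^sub>R v + b *\<^sub>R w = 0"
  have "b = 0"
  proof (rule ccontr)
    assume b: "b \<noteq> 0"
    have "b *\<^sub>R w = - (a *\<^sub>R v)" using eq by (simp add: eq_neg_iff_add_eq_0 add.commute)
    then have "inverse b *\<^sub>R (b *\<^sub>R w) = inverse b *\<^sub>R (- (a *\<^sub>R v))" by simp
    then have "w = (- (inverse b * a)) *\<^sub>R v" using b by simp
    then show False using assms(2) by blast
  qed
  then show "a = 0 \<and> b = 0" using eq assms(1) by simp
qed

lemma li2_nonzero:
  assumes "li2 v w" shows "v \<noteq> 0" "w \<noteq> 0"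
proof -
  show "v \<noteq> 0" using assms[unfolded li2_def, rule_format, of 1 0] by auto
  show "w \<noteq> 0" using assms[unfolded li2_def, rule_format, of 0 1] by auto
qed

lemma li2_not_scale: "li2 v w \<Longrightarrow> w \<noteq> c *\<^sub>R v"
  unfolding li2_def by (drule spec[of _ "c"], drule spec[of _ "-1"]) auto

lemma li2_coeffs:
  assumes "li2 v w" "a *\<^sub>R v + b *\<^sub>R w = c *\<^sub>R v + d *\<^sub>R w"
  shows "a = c \<and> b = d"
proof -
  have "(a - c) *\<^sub>R v + (b - d) *\<^sub>R w = 0" using assms(2) by (simp add: algebra_simps)
  then show ?thesis using assms(1) unfolding li2_def by fastforce
qed

lemma li2_independent:
  assumes "li2 v w" shows "v \<noteq> w" "independent {v, w}"
proof -
  show "v \<noteq> w" using li2_not_scale[OF assms, of 1] by auto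
  have "w \<notin> span {v}" using li2_not_scale[OF assms] by (auto simp: span_singleton)
  then have "independent {w, v}"
    using li2_nonzero[OF assms] by (intro independent_insertI) (simp_all add: real_vector.independent_empty)
  then show "independent {v, w}" by (simp add: insert_commute)
qed

text \<open>A pair \<open>v, w\<close> stands for the ray of \<open>v\<close> and the half-plane
  bounded by the line of \<open>v\<close> on the side of \<open>w\<close>. Two pairs give the same
  flag exactly when they differ by a triangular matrix with positive diagonal, so existence and
  uniqueness of the rotation between two flags turn into \<open>flag_transitive\<close> and
  \<open>flag_free\<close>.\<close>

locale rotations =
  fixes D :: "('a::real_vector \<Rightarrow> 'a) set"
  assumes dim3: "dim (UNIV :: 'a set) = 3"
    and lin: "d \<in> D \<Longrightarrow> linear d"
    and comp: "d \<in> D \<Longrightarrow> e \<in> D \<Longrightarrow> d \<circ> e \<in> D"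
    and inverse: "d \<in> D \<Longrightarrow> \<exists>e\<in>D. d \<circ> e = id \<and> e \<circ> d = id"
    and flag_transitive: "li2 v w \<Longrightarrow> li2 v' w' \<Longrightarrow>
      \<exists>d\<in>D. \<exists>p q r. p > 0 \<and> r > 0 \<and> d v = p *\<^sub>R v' \<and> d w = q *\<^sub>R v' + r *\<^sub>R w'"
    and flag_free: "d \<in> D \<Longrightarrow> li2 v w \<Longrightarrow> p > 0 \<Longrightarrow> r > 0 \<Longrightarrow>
      d v = p *\<^sub>R v \<Longrightarrow> d w = q *\<^sub>R v + r *\<^sub>R w \<Longrightarrow> d = id"

lemma rotation_group_imp_rotations:
  fixes D :: "('a::real_vector \<Rightarrow> 'a) set"
  assumes dim: "dim (UNIV :: 'a set) = 3" and rot: "rotation_group D"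
  shows "rotations D"
proof -
  define ry where "ry v = {t *\<^sub>R v | t. t \<ge> 0}" for v :: 'a
  define hp where "hp v w = {s *\<^sub>R v + t *\<^sub>R w | s t. t \<ge> 0}" for v w :: 'a
  interpret GL: group "GL :: ('a \<Rightarrow> 'a) monoid" by (rule group_GL)
  have sub: "subgroup D GL" using rot by (simp add: rotation_group_def)
  have carr: "linear d" "bij d" if "d \<in> D" for d
    using subgroup.subset[OF sub] that by (auto simp: GL_def)
  have idD: "id \<in> D" using subgroup.one_closed[OF sub] by (simp add: GL_def)
  have compD: "d \<circ> e \<in> D" if "d \<in> D" "e \<in> D" for d e
    using subgroup.m_closed[OF sub that] by (simp add: GL_def)
  have inv: "\<exists>e\<in>D. d \<circ> e = id \<and> e \<circ> d = id" if "d \<in> D" for d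
  proof (intro bexI conjI)
    show "inv\<^bsub>GL\<^esub> d \<in> D" using subgroup.m_inv_closed[OF sub that] .
    have "d \<in> carrier GL" using subgroup.subset[OF sub] that by auto
    from GL.r_inv[OF this] GL.l_inv[OF this]
    show "d \<circ> inv\<^bsub>GL\<^esub> d = id" "inv\<^bsub>GL\<^esub> d \<circ> d = id" by (simp_all add: GL_def)
  qed
  have flag: "half_plane (hp v w) \<and> ray (ry v) \<and> ry v \<subseteq> boundary_line (hp v w)" if "li2 v w" for v w
  proof (intro conjI)
    note i = li2_independent[OF that]
    show "half_plane (hp v w)" unfolding half_plane_def hp_def using i by blast
    show "ray (ry v)" unfolding ray_def ry_def using li2_nonzero[OF that] by blast
    show "ry v \<subseteq> boundary_line (hp v w)"
      unfolding hp_def boundary_line_half_plane[OF i] ry_def span_singleton by auto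
  qed
  have uniq: "\<exists>!d. d \<in> D \<and> d ` hp v w = hp v' w' \<and> d ` ry v = ry v'"
    if "li2 v w" "li2 v' w'" for v w v' w'
    using conjunct2[OF rot[unfolded rotation_group_def], rule_format,
        of "hp v w" "ry v" "hp v' w'" "ry v'"] flag[OF that(1)] flag[OF that(2)] by simp
  show ?thesis
  proof (rule rotations.intro)
    fix v w v' w' :: 'a
    assume li: "li2 v w" "li2 v' w'"
    obtain d where d: "d \<in> D" "d ` hp v w = hp v' w'" "d ` ry v = ry v'"
      using uniq[OF li] by blast
    interpret linear d using carr(1)[OF d(1)] .
    have inj: "d x = d y \<longleftrightarrow> x = y" for x y
      using carr(2)[OF d(1)] by (simp add: bij_is_inj inj_eq)
    have "v \<in> ry v" unfolding ry_def by (simp, rule exI[of _ 1]) simp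
    then have "d v \<in> ry v'" using d(3) by blast
    then obtain p where p: "p \<ge> 0" "d v = p *\<^sub>R v'" unfolding ry_def by blast
    have "w \<in> hp v w" unfolding hp_def by (simp, rule exI[of _ 0], rule exI[of _ 1]) simp
    then have "d w \<in> hp v' w'" using d(2) by blast
    then obtain q r where q: "r \<ge> 0" "d w = q *\<^sub>R v' + r *\<^sub>R w'" unfolding hp_def by blast
    have "p \<noteq> 0" using p inj[of v 0] li2_nonzero[OF li(1)] zero by auto
    moreover have "r \<noteq> 0"
    proof
      assume "r = 0"
      then have "d w = d ((q / p) *\<^sub>R v)" using q p \<open>p \<noteq> 0\<close> by (simp add: scale)
      then show False using inj li2_not_scale[OF li(1)] by blast
    qed
    ultimately show "\<exists>d\<in>D. \<exists>p q r. p > 0 \<and> r > 0 \<and> d v = p *\<^sub>R v' \<and> d w = q *\<^sub>R v' + r *\<^sub>R w'"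
      using d(1) p q by (metis less_eq_real_def)
  next
    fix d v w p q r
    assume d: "d \<in> D" and li: "li2 v w" and pr: "p > 0" "r > 0"
      and dv: "d v = p *\<^sub>R v" and dw: "d w = q *\<^sub>R v + r *\<^sub>R w"
    interpret linear d using carr(1)[OF d(1)] .
    have "d ` hp v w = hp v w"
    proof (intro equalityI subsetI)
      fix x assume "x \<in> d ` hp v w"
      then obtain s t where "t \<ge> 0" "x = d (s *\<^sub>R v + t *\<^sub>R w)" unfolding hp_def by blast
      then have "t * r \<ge> 0" "x = (s * p + t * q) *\<^sub>R v + (t * r) *\<^sub>R w"
        using pr by (simp_all add: add scale dv dw algebra_simps)
      then show "x \<in> hp v w" unfolding hp_def by blast
    next
      fix x assume "x \<in> hp v w"
      then obtain s t where st: "t \<ge> 0" "x = s *\<^sub>R v + t *\<^sub>R w" unfolding hp_def by blast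
      \<comment> \<open>Back substitution in the triangular system for a preimage of
        \<open>x\<close> under \<open>d\<close>.\<close>
      define s' where "s' = (s - t / r * q) / p"
      have s': "s = s' * p + t / r * q" using pr by (simp add: s'_def)
      have "d (s' *\<^sub>R v + (t / r) *\<^sub>R w) = (s' * p + t / r * q) *\<^sub>R v + (t / r * r) *\<^sub>R w"
        by (simp add: add scale dv dw scaleR_add_left scaleR_add_right)
      then have "x = d (s' *\<^sub>R v + (t / r) *\<^sub>R w)" using pr st s' by simp
      moreover have "t / r \<ge> 0" using st pr by simp
      ultimately show "x \<in> d ` hp v w" unfolding hp_def by blast
    qed
    moreover have "d ` ry v = ry v"
    proof (intro equalityI subsetI)
      fix x assume "x \<in> d ` ry v"
      then obtain t where "t \<ge> 0" "x = d (t *\<^sub>R v)" unfolding ry_def by blast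
      then have "t * p \<ge> 0" "x = (t * p) *\<^sub>R v" using pr by (simp_all add: scale dv)
      then show "x \<in> ry v" unfolding ry_def by blast
    next
      fix x assume "x \<in> ry v"
      then obtain t where t: "t \<ge> 0" "x = t *\<^sub>R v" unfolding ry_def by blast
      then have "t / p \<ge> 0" "x = d ((t / p) *\<^sub>R v)" using pr by (simp_all add: scale dv)
      then show "x \<in> d ` ry v" unfolding ry_def by blast
    qed
    moreover have "id ` hp v w = hp v w" "id ` ry v = ry v" by simp_all
    ultimately show "d = id" using uniq[OF li li] d idD by blast
  qed (rule dim, erule carr, erule (1) compD, erule inv)
qed

section \<open>Half-turns\<close>

context rotations
begin

section \<open>Dimension count\<close>

lemma exists_not_in_span:
  assumes "finite T" "card T < 3"
  shows "\<exists>y::'a. y \<notin> span T"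
proof (rule ccontr)
  assume "\<not> ?thesis"
  then have "UNIV \<subseteq> span T" by blast
  moreover obtain B :: "'a set" where "independent B" "card B = 3"
    using real_vector.basis_exists[of UNIV] dim3 by metis
  ultimately show False
    using real_vector.independent_span_bound[of T B] assms by auto
qed

lemma independent_spans:
  assumes "independent (B :: 'a set)" "card B = 3"
  shows "span B = UNIV"
proof (rule ccontr)
  assume "span B \<noteq> UNIV"
  then obtain x where x: "x \<notin> span B" by blast
  have fin: "finite B" using assms(2) by (simp add: card_ge_0_finite)
  obtain C :: "'a set" where C: "UNIV \<subseteq> span C" "card C = 3"
    using real_vector.basis_exists[of UNIV] dim3 by metis
  have "x \<notin> B" using x by (meson span_base)
  moreover have "independent (insert x B)" using x assms(1) by (rule independent_insertI)
  moreover have "finite C" using C(2) by (simp add: card_ge_0_finite)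
  ultimately show False
    using real_vector.independent_span_bound[of C "insert x B"] C fin assms(2) by auto
qed

text \<open>A rotation \<open>d\<close> taking the flag of \<open>v, w\<close> to that of
  \<open>v, - w\<close> has a square that preserves the first flag, so \<open>d\<close> is an
  involution; it fixes \<open>v\<close> and is not the identity. Every \<open>x + d x\<close> is
  fixed by \<open>d\<close>; were one independent of \<open>v\<close>, then \<open>d\<close> would
  preserve a flag and be the identity.\<close>

lemma half_turn_exists:
  assumes v: "v \<noteq> 0"
  shows "\<exists>h\<in>D. h v = v \<and> (\<forall>x. \<exists>c. h x = c *\<^sub>R v - x)"
proof -
  obtain w where "w \<notin> span {v}" using exists_not_in_span[of "{v}"] by auto
  then have li: "li2 v w" using v by (intro li2I) (auto simp: span_singleton)
  have "- w \<noteq> c *\<^sub>R v" for c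
    using li2_not_scale[OF li, of "- c"] by (metis add.inverse_inverse scaleR_minus_left)
  then have li': "li2 v (- w)" using v by (intro li2I)
  obtain d p q r where d: "d \<in> D" "p > 0" "r > 0" "d v = p *\<^sub>R v" "d w = q *\<^sub>R v + r *\<^sub>R (- w)"
    using flag_transitive[OF li li'] by blast
  interpret linear d using lin d(1) .
  have dd: "(d \<circ> d) v = (p * p) *\<^sub>R v"
    "(d \<circ> d) w = (q * p - r * q) *\<^sub>R v + (r * r) *\<^sub>R w"
    by (simp_all add: d(4,5) add scale neg diff algebra_simps)
  have "d \<circ> d = id"
    by (rule flag_free[OF comp[OF d(1) d(1)] li _ _ dd]) (use d in auto)
  then have dd_id: "d (d x) = x" for x by (metis comp_apply id_apply)
  have "(p * p - 1) *\<^sub>R v = 0" using dd(1) dd_id[of v] by (simp add: algebra_simps)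
  then have "p * p = 1" using v by simp
  then have "p = 1" using d(2) by (auto simp: square_eq_1_iff)
  then have dv: "d v = v" using d by simp
  have "d \<noteq> id"
  proof
    assume "d = id"
    then have "q *\<^sub>R v + (- r) *\<^sub>R w = 0 *\<^sub>R v + 1 *\<^sub>R w" using d(5) by simp
    then have "- r = 1" using li2_coeffs[OF li] by blast
    then show False using d(3) by simp
  qed
  have "\<exists>c. d x = c *\<^sub>R v - x" for x
  proof -
    have fixed: "d (x + d x) = x + d x" by (simp add: add dd_id add.commute)
    have "\<exists>c. x + d x = c *\<^sub>R v"
    proof (rule ccontr)
      assume "\<not> ?thesis"
      then have "li2 v (x + d x)" using v by (intro li2I) auto
      from flag_free[OF d(1) this, of 1 1 0] have "d = id" using dv fixed by simp
      then show False using \<open>d \<noteq> id\<close> by simp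
    qed
    then show ?thesis by (metis add_diff_cancel_left')
  qed
  then show ?thesis using d(1) dv by blast
qed

text \<open>\<open>phi v x\<close> plays the role of \<open>\<langle>v, x\<rangle> / \<langle>v, v\<rangle>\<close>; it is meaningful only for \<open>v \<noteq> 0\<close>.\<close>

definition half_turn :: "'a \<Rightarrow> 'a \<Rightarrow> 'a" where
  "half_turn v = (SOME h. h \<in> D \<and> h v = v \<and> (\<forall>x. \<exists>c. h x = c *\<^sub>R v - x))"

definition phi :: "'a \<Rightarrow> 'a \<Rightarrow> real" where
  "phi v x = (SOME c. half_turn v x = (2 * c) *\<^sub>R v - x)"

lemma half_turn:
  assumes "v \<noteq> 0"
  shows half_turn_in: "half_turn v \<in> D"
    and half_turn_axis: "half_turn v v = v"
    and half_turn_eq: "half_turn v x = (2 * phi v x) *\<^sub>R v - x"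
proof -
  have *: "half_turn v \<in> D \<and> half_turn v v = v \<and> (\<forall>x. \<exists>c. half_turn v x = c *\<^sub>R v - x)"
    using someI_ex[OF half_turn_exists[OF assms, unfolded Bex_def], folded half_turn_def] .
  then show "half_turn v \<in> D" "half_turn v v = v" by auto
  obtain c where "half_turn v x = c *\<^sub>R v - x" using * by blast
  then have "half_turn v x = (2 * (c / 2)) *\<^sub>R v - x" by simp
  then show "half_turn v x = (2 * phi v x) *\<^sub>R v - x"
    unfolding phi_def by (rule someI)
qed

lemma phi_self: "v \<noteq> 0 \<Longrightarrow> phi v v = 1"
proof -
  assume v: "v \<noteq> 0"
  have "(2 * phi v v) *\<^sub>R v = 2 *\<^sub>R v"
    using half_turn_axis[OF v] half_turn_eq[OF v, of v] by (simp add: algebra_simps scaleR_2)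
  then show ?thesis using v by simp
qed

lemma phi_linear:
  assumes v: "v \<noteq> 0"
  shows "linear (phi v)"
proof (rule linearI)
  interpret linear "half_turn v" using lin half_turn_in[OF v] .
  have eq: "(2 * phi v x) *\<^sub>R v = half_turn v x + x" for x using half_turn_eq[OF v] by simp
  fix x y c
  have "(2 * phi v (x + y)) *\<^sub>R v = (2 * (phi v x + phi v y)) *\<^sub>R v"
    unfolding eq by (simp add: distrib_left scaleR_add_left eq add)
  then show "phi v (x + y) = phi v x + phi v y" using v by simp
  have "(2 * phi v (c *\<^sub>R x)) *\<^sub>R v = c *\<^sub>R ((2 * phi v x) *\<^sub>R v)"
    unfolding eq by (simp add: scale scaleR_add_right)
  then show "phi v (c *\<^sub>R x) = c *\<^sub>R phi v x" using v by simp
qed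

lemma phi_simps:
  assumes "v \<noteq> 0"
  shows phi_add: "phi v (x + y) = phi v x + phi v y"
    and phi_diff: "phi v (x - y) = phi v x - phi v y"
    and phi_neg: "phi v (- x) = - phi v x"
    and phi_scale: "phi v (c *\<^sub>R x) = c * phi v x"
    and phi_zero: "phi v 0 = 0"
proof -
  interpret linear "phi v" by (rule phi_linear[OF assms])
  show "phi v (x + y) = phi v x + phi v y" "phi v (x - y) = phi v x - phi v y"
    "phi v (- x) = - phi v x" "phi v (c *\<^sub>R x) = c * phi v x" "phi v 0 = 0"
    by (simp_all add: add diff neg scale zero)
qed

lemma half_turn_involution:
  assumes "v \<noteq> 0" shows "half_turn v (half_turn v x) = x"
proof -
  have "phi v (half_turn v x) = phi v x"
    by (simp add: half_turn_eq[OF assms] phi_diff[OF assms] phi_scale[OF assms] phi_self[OF assms])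
  then show ?thesis by (simp add: half_turn_eq[OF assms])
qed

text \<open>Followed by the half-turn about \<open>v\<close>, the rotation \<open>d\<close>
  preserves the flag of \<open>v, w\<close>, so the composite is the identity. A single vector off
  the axis thus suffices to recognise a half-turn.\<close>

lemma half_turn_unique:
  assumes v: "v \<noteq> 0" and w: "li2 v w" and d: "d \<in> D" "d v = v" "d w = c *\<^sub>R v - w"
  shows "d = half_turn v"
proof -
  interpret linear "half_turn v" using lin half_turn_in[OF v] .
  have "half_turn v \<circ> d = id"
  proof (rule flag_free[OF comp w])
    show "half_turn v \<in> D" using half_turn_in[OF v] .
    show "d \<in> D" by fact
    show "(half_turn v \<circ> d) v = 1 *\<^sub>R v" using d v by (simp add: half_turn_axis)
    show "(half_turn v \<circ> d) w = (c - 2 * phi v w) *\<^sub>R v + 1 *\<^sub>R w"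
      using v by (simp add: d(3) diff scale half_turn_axis half_turn_eq algebra_simps)
  qed auto
  then have "half_turn v (d x) = x" for x by (metis comp_apply id_apply)
  then have "d x = half_turn v x" for x using half_turn_involution[OF v, of "d x"] by simp
  then show ?thesis by (rule ext)
qed

text \<open>This is how \<open>phi\<close> gets computed: a rotation of half-turn shape is the
  half-turn itself, so its coefficient function is forced. The condition \<open>f v = 1\<close>
  makes \<open>d\<close> fix \<open>v\<close>.\<close>

lemma phi_unique:
  assumes v: "v \<noteq> 0" and d: "d \<in> D" "\<And>x. d x = (2 * f x) *\<^sub>R v - x" "f v = 1"
  shows "f = phi v"
proof -
  obtain w where "w \<notin> span {v}" using exists_not_in_span[of "{v}"] by auto
  then have "li2 v w" using v by (intro li2I) (auto simp: span_singleton)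
  from half_turn_unique[OF v this d(1) _ d(2)] have "d = half_turn v"
    using d(2)[of v] d(3) by (simp add: scaleR_2)
  then have "(2 * f x) *\<^sub>R v = (2 * phi v x) *\<^sub>R v"
    for x using d(2)[of x] half_turn_eq[OF v, of x] \<open>d = half_turn v\<close> by (simp only: diff_eq_eq) simp
  then show ?thesis using v by (intro ext) simp
qed

section \<open>Scaling, invariance and symmetry of \<open>phi\<close>\<close>

lemma phi_scale_left:
  assumes "v \<noteq> 0" "c \<noteq> 0"
  shows "phi (c *\<^sub>R v) x = phi v x / c"
proof -
  \<comment> \<open>The half-turn about \<open>v\<close> also has half-turn shape for the axis
    \<open>c *\<^sub>R v\<close>, with its coefficient divided by \<open>c\<close>.\<close>
  have "(\<lambda>x. phi v x / c) = phi (c *\<^sub>R v)"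
    by (rule phi_unique[OF _ half_turn_in[OF assms(1)]])
      (use assms in \<open>auto simp: phi_scale phi_self half_turn_eq\<close>)
  then show ?thesis by metis
qed

lemma rotation_nonzero:
  assumes "d \<in> D" "v \<noteq> 0" shows "d v \<noteq> 0"
proof
  assume "d v = 0"
  obtain e where e: "e \<in> D" "e \<circ> d = id" using inverse[OF assms(1)] by blast
  then have "v = e (d v)" by (metis comp_apply id_apply)
  then show False using \<open>d v = 0\<close> assms(2) linear_0[OF lin[OF e(1)]] by simp
qed

text \<open>Conjugation by \<open>d\<close> turns the half-turn about \<open>v\<close> into a
  rotation of half-turn shape about \<open>d v\<close>.\<close>

lemma phi_equivariant:
  assumes d: "d \<in> D" and v: "v \<noteq> 0"
  shows "phi (d v) (d x) = phi v x"
proof -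
  obtain e where e: "e \<in> D" "d \<circ> e = id" "e \<circ> d = id" using inverse[OF d] by blast
  then have de: "d (e y) = y" "e (d y) = y" for y by (metis comp_apply id_apply)+
  interpret linear d using lin[OF d] .
  have "(\<lambda>y. phi v (e y)) = phi (d v)"
  proof (rule phi_unique)
    show "d v \<noteq> 0" using rotation_nonzero[OF d v] .
    show "d \<circ> (half_turn v \<circ> e) \<in> D" using comp d e half_turn_in[OF v] by blast
    show "phi v (e (d v)) = 1" using v by (simp add: de phi_self)
    show "(d \<circ> (half_turn v \<circ> e)) x = (2 * phi v (e x)) *\<^sub>R d v - x" for x
      using v by (simp add: half_turn_eq diff scale de)
  qed
  then show ?thesis by (metis de(2))
qed

text \<open>The half-turn about \<open>v\<close> fixes \<open>v\<close> and negates
  \<open>w\<close>, so invariance gives \<open>phi w v = phi (- w) v\<close>, which is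
  \<open>- phi w v\<close>.\<close>

lemma phi_symmetric:
  assumes "v \<noteq> 0" "w \<noteq> 0" "phi v w = 0"
  shows "phi w v = 0"
proof -
  have "half_turn v w = (- 1) *\<^sub>R w" using assms by (simp add: half_turn_eq)
  then have "phi w v = phi ((- 1) *\<^sub>R w) v"
    using phi_equivariant[OF half_turn_in[OF assms(1)] assms(2), of v] half_turn_axis[OF assms(1)]
    by simp
  also have "\<dots> = - phi w v" using phi_scale_left[OF assms(2), of "-1" v] by simp
  finally show ?thesis by simp
qed

text \<open>A nonzero \<open>w\<close> lies off the line of \<open>v\<close>, which \<open>d\<close>
  fixes pointwise; hence \<open>d\<close> is the half-turn about \<open>v\<close>, and negating
  \<open>w\<close> means a zero coefficient.\<close>

lemma orthogonal_wrt_imp_phi: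
  assumes "d \<in> D" "d v = v" "d w = - w" "v \<noteq> 0"
  shows "phi v w = 0"
proof (cases "w = 0")
  case False
  have "li2 v w"
  proof (rule li2I[OF assms(4)])
    fix c show "w \<noteq> c *\<^sub>R v"
    proof
      assume w: "w = c *\<^sub>R v"
      then have "d w = w" using assms(2) linear_scale[OF lin[OF assms(1)]] by simp
      then have "w = - w" using assms(3) by simp
      then have "2 *\<^sub>R w = 0" by (metis add.right_inverse scaleR_2)
      then show False using False by simp
    qed
  qed
  then have "d = half_turn v"
    using half_turn_unique[OF assms(4) _ assms(1,2), of w 0] assms(3) by simp
  then show ?thesis using assms(3,4) half_turn_eq[of v w] by simp
qed (use assms in \<open>simp add: phi_zero\<close>)


section \<open>Orthonormal frames\<close>

text \<open>Nonzero, pairwise orthogonal vectors are independent, hence a basis, and each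
  \<open>phi\<close> reads off its own coordinate.\<close>

lemma orthogonal_spans:
  assumes nz: "e1 \<noteq> 0" "e2 \<noteq> 0" "e3 \<noteq> 0"
    and orth: "phi e1 e2 = 0" "phi e1 e3 = 0" "phi e2 e3 = 0"
  shows "x = phi e1 x *\<^sub>R e1 + phi e2 x *\<^sub>R e2 + phi e3 x *\<^sub>R e3"
proof -
  note orth' = orth phi_symmetric[OF nz(1,2) orth(1)] phi_symmetric[OF nz(1,3) orth(2)]
    phi_symmetric[OF nz(2,3) orth(3)]
  have "e2 \<notin> span {e3}"
    using nz orth' by (auto simp: span_singleton phi_scale phi_self)
  then have ind: "independent {e2, e3}"
    using nz by (intro independent_insertI) (simp_all add: real_vector.independent_empty)
  have "phi e1 y = 0" if "y \<in> span {e2, e3}" for y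
    using linear_eq_0_on_span[OF phi_linear[OF nz(1)] _ that] orth by auto
  then have "e1 \<notin> span {e2, e3}" using phi_self[OF nz(1)] by auto
  then have "independent {e1, e2, e3}" using ind by (rule independent_insertI)
  moreover have "e1 \<noteq> e2" "e1 \<noteq> e3" "e2 \<noteq> e3"
    using orth nz phi_self by force+
  ultimately have "span {e1, e2, e3} = UNIV" by (intro independent_spans) auto
  then have "x \<in> span {e1, e2, e3}" by simp
  then obtain a b c where "x = a *\<^sub>R e1 + b *\<^sub>R e2 + c *\<^sub>R e3"
    by (auto simp: span_insert span_singleton) (metis add.assoc diff_add_cancel diff_eq_eq add.commute)
  moreover from this have "phi e1 x = a" "phi e2 x = b" "phi e3 x = c"
    using nz orth' by (simp_all add: phi_add phi_scale phi_self)
  ultimately show ?thesis by simp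
qed

text \<open>A rotation \<open>d\<close> from the flag of \<open>v, w\<close> to that of
  \<open>w, v\<close> swaps the two lines, since invariance of \<open>phi\<close> removes the entry
  \<open>q\<close>. Its square preserves a flag, so \<open>d\<close> exchanges \<open>v\<close> with
  \<open>p *\<^sub>R w\<close>; it fixes their sum and negates their difference.\<close>

lemma normalise:
  assumes nz: "v \<noteq> 0" "w \<noteq> 0" and orth: "phi v w = 0"
  shows "\<exists>p>0. phi (v + p *\<^sub>R w) (v - p *\<^sub>R w) = 0"
proof -
  have orth': "phi w v = 0" using phi_symmetric[OF nz orth] .
  have li: "li2 v w" "li2 w v"
    using nz orth orth' by (auto intro!: li2I simp: phi_scale phi_self)
  obtain d p q r where d: "d \<in> D" "p > 0" "r > 0" "d v = p *\<^sub>R w" "d w = q *\<^sub>R w + r *\<^sub>R v"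
    using flag_transitive[OF li] by blast
  interpret linear d using lin d(1) .
  have "phi (p *\<^sub>R w) (q *\<^sub>R w + r *\<^sub>R v) = 0"
    using phi_equivariant[OF d(1) nz(1), of w] orth by (simp add: d(4,5))
  then have "q = 0"
    using nz d(2) orth' by (simp add: phi_scale_left phi_add phi_scale phi_self)
  then have dw: "d w = r *\<^sub>R v" by (simp add: d(5))
  have "d \<circ> d = id"
    by (rule flag_free[OF comp[OF d(1) d(1)] li(1), of "p * r" "r * p" 0])
      (simp_all add: d(2,3,4) dw scale)
  then have "d (d v) = v" by (metis comp_apply id_apply)
  then have dpw: "d (p *\<^sub>R w) = v" by (simp add: d(4))
  have "v + p *\<^sub>R w \<noteq> 0"
    using li(1)[unfolded li2_def, rule_format, of 1 p] by auto
  from phi_equivariant[OF d(1) this, of "v - p *\<^sub>R w"]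
  have "phi (v + p *\<^sub>R w) (- (v - p *\<^sub>R w)) = phi (v + p *\<^sub>R w) (v - p *\<^sub>R w)"
    by (simp add: add diff d(4) dpw add.commute)
  then have "phi (v + p *\<^sub>R w) (v - p *\<^sub>R w) = 0"
    using phi_neg[OF \<open>v + p *\<^sub>R w \<noteq> 0\<close>, of "v - p *\<^sub>R w"] by simp
  then show ?thesis using d(2) by blast
qed

text \<open>Gram-Schmidt, with \<open>phi v x *\<^sub>R v\<close> as the projection of
  \<open>x\<close> to the line of \<open>v\<close>; then \<open>normalise\<close> rescales the
  second and third vectors to match the first.\<close>

lemma orthonormal_frame:
  "\<exists>e1 e2 e3. e1 \<noteq> 0 \<and> e2 \<noteq> 0 \<and> e3 \<noteq> 0 \<and> phi e1 e2 = 0 \<and> phi e1 e3 = 0 \<and> phi e2 e3 = 0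
     \<and> phi (e1 + e2) (e1 - e2) = 0 \<and> phi (e1 + e3) (e1 - e3) = 0"
proof -
  obtain e1 :: 'a where "e1 \<notin> span {}" using exists_not_in_span[of "{}"] by auto
  then have e1: "e1 \<noteq> 0" by simp
  obtain y where y: "y \<notin> span {e1}" using exists_not_in_span[of "{e1}"] by auto
  define e2 where "e2 = y - phi e1 y *\<^sub>R e1"
  have e2: "e2 \<noteq> 0" using y by (auto simp: e2_def span_singleton)
  have o12: "phi e1 e2 = 0" using e1 by (simp add: e2_def phi_diff phi_scale phi_self)
  have o21: "phi e2 e1 = 0" using phi_symmetric[OF e1 e2 o12] .
  have "card {e1, e2} < 3" using card_insert_le_m1[of 2 "{e2}" e1] by simp
  then obtain z where z: "z \<notin> span {e1, e2}" using exists_not_in_span[of "{e1, e2}"] by auto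
  define e3 where "e3 = z - (phi e1 z *\<^sub>R e1 + phi e2 z *\<^sub>R e2)"
  have "phi e1 z *\<^sub>R e1 + phi e2 z *\<^sub>R e2 \<in> span {e1, e2}"
    by (intro span_add span_scale span_base) auto
  then have e3: "e3 \<noteq> 0" using z by (auto simp: e3_def)
  have o13: "phi e1 e3 = 0" and o23: "phi e2 e3 = 0"
    using e1 e2 o12 o21 by (simp_all add: e3_def phi_diff phi_add phi_scale phi_self)
  obtain p where p: "p > 0" "phi (e1 + p *\<^sub>R e2) (e1 - p *\<^sub>R e2) = 0"
    using normalise[OF e1 e2 o12] by blast
  obtain q where q: "q > 0" "phi (e1 + q *\<^sub>R e3) (e1 - q *\<^sub>R e3) = 0"
    using normalise[OF e1 e3 o13] by blast
  show ?thesis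
    by (rule exI[of _ e1], rule exI[of _ "p *\<^sub>R e2"], rule exI[of _ "q *\<^sub>R e3"])
      (use e1 e2 e3 o12 o13 o23 p q in \<open>simp add: phi_scale phi_scale_left\<close>)
qed

end

section \<open>Rigidity of the coordinate functions\<close>

text \<open>Nonnegative reals are squares, so \<open>f\<close> is monotone; it fixes the rationals,
  which are dense.\<close>

lemma additive_multiplicative_real_eq_id:
  fixes f :: "real \<Rightarrow> real"
  assumes add: "\<And>x y. f (x + y) = f x + f y"
    and mult: "\<And>x y. f (x * y) = f x * f y" and one: "f 1 = 1"
  shows "f x = x"
proof -
  have zero: "f 0 = 0" using add[of 0 0] by simp
  have neg: "f (- x) = - f x" for x using add[of x "- x"] zero by simp
  have nat: "f (of_nat n) = of_nat n" for n
    by (induction n) (simp_all add: zero add one)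
  have int: "f (of_int k) = of_int k" for k
    by (cases k rule: int_diff_cases) (metis add neg nat of_int_diff of_int_of_nat_eq uminus_add_conv_diff add.commute)
  have rat: "f q = q" if Rats: "q \<in> \<rat>" for q
  proof -
    obtain a b where q: "b > 0" "q = of_int a / of_int b" by (rule Rats_cases'[OF Rats]) blast
    then have qb: "q * of_int b = of_int a" by simp
    have "f q * of_int b = f (q * of_int b)" by (simp only: mult int)
    also have "\<dots> = q * of_int b" by (simp only: qb int)
    finally have "f q * of_int b = q * of_int b" .
    then show ?thesis using q(1) by auto
  qed
  have nonneg: "f x \<ge> 0" if "x \<ge> 0" for x
    using mult[of "sqrt x" "sqrt x"] that by simp
  have mono: "f x \<le> f y" if "x \<le> y" for x y
    using nonneg[of "y - x"] add[of "y - x" x] that by simp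
  show ?thesis
  proof (rule ccontr)
    assume "f x \<noteq> x"
    then consider "f x < x" | "x < f x" by linarith
    then show False
    proof cases
      case 1
      then obtain q where "q \<in> \<rat>" "f x < q" "q < x" using Rats_dense_in_real by blast
      then show False using mono[of q x] rat by simp
    next
      case 2
      then obtain q where "q \<in> \<rat>" "x < q" "q < f x" using Rats_dense_in_real by blast
      then show False using mono[of x q] rat by simp
    qed
  qed
qed

text \<open>Read \<open>1 + f t * x + g s * y = 0\<close> as the polar line of the point
  \<open>(t, s)\<close>; \<open>sym\<close> says that incidence of points with polars is symmetric.
  Well-chosen incident pairs give functional equations that make \<open>f\<close> multiplicative and
  then additive.\<close>

lemma symmetric_polarity_trivial:
  fixes f g :: "real \<Rightarrow> real"
  assumes sym: "\<And>t s t' s'. 1 + f t * t' + g s * s' = 0 \<Longrightarrow> 1 + f t' * t + g s' * s = 0"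
    and f1: "f 1 = 1" and g1: "g 1 = 1"
    and fodd: "\<And>t. f (- t) = - f t" and godd: "\<And>t. g (- t) = - g t"
  shows "f x = x" "g x = x"
proof -
  \<comment> \<open>Since \<open>g 1 = 1\<close>, the point \<open>(u, - (1 + f t * u))\<close> lies
    on the polar line of \<open>(t, 1)\<close>.\<close>
  have g_aff: "g (1 + f t * u) = 1 + f u * t" for t u
    using sym[of t u 1 "- (1 + f t * u)"] godd[of "1 + f t * u"] g1 by simp
  have f_aff: "f (1 + g t * u) = 1 + g u * t" for t u
    using sym[of 1 "- (1 + g t * u)" t u] fodd[of "1 + g t * u"] f1 by simp
  have g_Suc: "g (1 + u) = 1 + f u" for u using g_aff[of 1 u] f1 by simp
  have f_Suc: "f (1 + u) = 1 + g u" for u using f_aff[of 1 u] g1 by simp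
  \<comment> \<open>Setting \<open>u = 1\<close> shows that \<open>f\<close> is an involution;
    replacing \<open>t\<close> by \<open>f t\<close> then gives multiplicativity.\<close>
  have "f (f t * u) = f u * t" for t u using g_aff[of t u] g_Suc by simp
  from this[of _ 1] this[of "f _"] have fmult: "f (t * u) = f t * f u" for t u
    using f1 by (simp add: mult.commute)
  have f_Suc2: "f (2 + u) = 2 + f u" for u
    using f_Suc[of "1 + u"] g_Suc[of u] by (simp add: add.assoc[symmetric])
  have f0: "f 0 = 0" using fodd[of 0] by simp
  have f2: "f 2 = 2" using f_Suc2[of 0] f0 by simp
  \<comment> \<open>A shift by 1 exchanges \<open>f\<close> and \<open>g\<close>, so only the shift
    by 2 is known for \<open>f\<close> alone; multiplicativity with \<open>f 2 = 2\<close> halves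
    it.\<close>
  have f_Suc1: "f (1 + u) = 1 + f u" for u
  proof -
    have "2 * f (1 + u) = f (2 + 2 * u)" using fmult[of 2 "1 + u"] f2 by simp
    also have "\<dots> = 2 + 2 * f u" using f_Suc2[of "2 * u"] fmult[of 2 u] f2 by simp
    finally show ?thesis by simp
  qed
  have fadd: "f (x + y) = f x + f y" for x y
  proof (cases "x = 0")
    case False
    then have "f (x + y) = f (x * (1 + y / x))" by (simp add: distrib_left)
    also have "\<dots> = f x + f (x * (y / x))"
      by (simp only: fmult f_Suc1) (simp only: distrib_left mult_1_right)
    finally show ?thesis using False by simp
  qed (simp add: f0)
  show fx: "f x = x" for x by (rule additive_multiplicative_real_eq_id[OF fadd fmult f1])
  then show "g x = x" using f_Suc[of x] by simp
qed

section \<open>The invariant inner product\<close>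

text \<open>The assumptions \<open>normal\<close> express, before any length is available, that
  \<open>e2\<close> and \<open>e3\<close> are as long as \<open>e1\<close>.\<close>

locale frame = rotations D for D :: "('a::real_vector \<Rightarrow> 'a) set" +
  fixes e1 e2 e3 :: 'a
  assumes nz: "e1 \<noteq> 0" "e2 \<noteq> 0" "e3 \<noteq> 0"
    and orth: "phi e1 e2 = 0" "phi e1 e3 = 0" "phi e2 e3 = 0"
    and normal: "phi (e1 + e2) (e1 - e2) = 0" "phi (e1 + e3) (e1 - e3) = 0"
begin

lemma orth_sym: "phi e2 e1 = 0" "phi e3 e1 = 0" "phi e3 e2 = 0"
  using phi_symmetric nz orth by blast+

lemmas coords = orth orth_sym phi_self[OF nz(1)] phi_self[OF nz(2)] phi_self[OF nz(3)]
  phi_simps[OF nz(1)] phi_simps[OF nz(2)] phi_simps[OF nz(3)]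

lemma expand: "x = phi e1 x *\<^sub>R e1 + phi e2 x *\<^sub>R e2 + phi e3 x *\<^sub>R e3"
  using orthogonal_spans nz orth by blast

section \<open>Polar planes of points in the affine chart of first coordinate 1\<close>

definition pt :: "real \<Rightarrow> real \<Rightarrow> 'a" where
  "pt t s = e1 + t *\<^sub>R e2 + s *\<^sub>R e3"

lemma phi_pt: "phi e1 (pt t s) = 1" "phi e2 (pt t s) = t" "phi e3 (pt t s) = s"
  by (simp_all add: pt_def coords)

lemma pt_nonzero: "pt t s \<noteq> 0"
  using phi_pt(1)[of t s] by (auto simp: coords)

lemma phi_pt_e1: "phi (pt t s) e1 \<noteq> 0"
  using phi_symmetric[OF pt_nonzero nz(1)] phi_pt(1)[of t s] by force

text \<open>The \<open>e2\<close> coefficient of the polar plane of \<open>pt t 0\<close>, scaled so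
  that the \<open>e1\<close> coefficient is 1; the divisor is nonzero by
  \<open>phi_pt_e1\<close>.\<close>

definition slope2 :: "real \<Rightarrow> real" where
  "slope2 t = phi (pt t 0) e2 / phi (pt t 0) e1"

definition slope3 :: "real \<Rightarrow> real" where
  "slope3 s = phi (pt 0 s) e3 / phi (pt 0 s) e1"

text \<open>The coefficient does not depend on \<open>s\<close>: the vector \<open>y\<close> is
  orthogonal to \<open>pt t 0\<close> and to \<open>e3\<close>, hence, by symmetry and linearity of
  \<open>phi y\<close>, to \<open>pt t s\<close>.\<close>

lemma phi_pt_e2: "phi (pt t s) e2 = slope2 t * phi (pt t s) e1"
proof -
  define y where "y = e2 - slope2 t *\<^sub>R e1"
  have "phi e2 y = 1" by (simp add: y_def coords)
  then have y: "y \<noteq> 0" by (auto simp: coords)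
  have "phi (pt t 0) y = 0"
    using phi_pt_e1[of t 0] by (simp add: y_def slope2_def phi_simps[OF pt_nonzero])
  then have "phi y (pt t 0) = 0" using phi_symmetric[OF pt_nonzero y] by simp
  moreover have "phi y e3 = 0"
    by (rule phi_symmetric[OF nz(3) y]) (simp add: y_def coords)
  ultimately have "phi y (pt t s) = 0"
    by (simp add: pt_def phi_simps[OF y])
  then have "phi (pt t s) y = 0" using phi_symmetric[OF y pt_nonzero] by simp
  then show ?thesis by (simp add: y_def phi_simps[OF pt_nonzero])
qed

text \<open>The same argument with the roles of \<open>e2\<close> and \<open>e3\<close>
  exchanged.\<close>

lemma phi_pt_e3: "phi (pt t s) e3 = slope3 s * phi (pt t s) e1"
proof -
  define y where "y = e3 - slope3 s *\<^sub>R e1"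
  have "phi e3 y = 1" by (simp add: y_def coords)
  then have y: "y \<noteq> 0" by (auto simp: coords)
  have "phi (pt 0 s) y = 0"
    using phi_pt_e1[of 0 s] by (simp add: y_def slope3_def phi_simps[OF pt_nonzero])
  then have "phi y (pt 0 s) = 0" using phi_symmetric[OF pt_nonzero y] by simp
  moreover have "phi y e2 = 0"
    by (rule phi_symmetric[OF nz(2) y]) (simp add: y_def coords)
  ultimately have "phi y (pt t s) = 0"
    by (simp add: pt_def phi_simps[OF y])
  then have "phi (pt t s) y = 0" using phi_symmetric[OF y pt_nonzero] by simp
  then show ?thesis by (simp add: y_def phi_simps[OF pt_nonzero])
qed

lemma phi_pt_slopes:
  "phi (pt t s) y = phi (pt t s) e1 * (phi e1 y + slope2 t * phi e2 y + slope3 s * phi e3 y)"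
proof -
  have "phi (pt t s) y = phi e1 y * phi (pt t s) e1 + phi e2 y * phi (pt t s) e2
      + phi e3 y * phi (pt t s) e3"
    by (subst expand[of y]) (simp only: phi_simps[OF pt_nonzero])
  then show ?thesis by (simp add: phi_pt_e2 phi_pt_e3 algebra_simps)
qed

text \<open>Symmetry of orthogonality between chart points is the hypothesis of
  \<open>symmetric_polarity_trivial\<close>. The values at 1 come from \<open>normal\<close>, and
  oddness from the half-turn about \<open>e1\<close>, which negates both chart coordinates.\<close>

lemma slopes_eq_id: "slope2 t = t" "slope3 s = s"
proof -
  have sym: "1 + slope2 t' * t + slope3 s' * s = 0" if "1 + slope2 t * t' + slope3 s * s' = 0"
    for t s t' s'
  proof -
    have "phi (pt t s) (pt t' s') = 0"
      using that by (simp add: phi_pt_slopes[of t s "pt t' s'"] phi_pt)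
    then have "phi (pt t' s') (pt t s) = 0" using phi_symmetric[OF pt_nonzero pt_nonzero] by simp
    then show ?thesis using phi_pt_e1 by (simp add: phi_pt_slopes[of t' s' "pt t s"] phi_pt)
  qed
  have one: "slope2 1 = 1" "slope3 1 = 1"
    using phi_pt_e1[of 1 0] phi_pt_e1[of 0 1] normal
      phi_diff[OF pt_nonzero[of 1 0], of e1 e2] phi_diff[OF pt_nonzero[of 0 1], of e1 e3]
    by (simp_all add: slope2_def slope3_def pt_def)
  have h: "linear (half_turn e1)" "half_turn e1 \<in> D" using lin half_turn_in nz by blast+
  have e: "half_turn e1 e1 = e1" "half_turn e1 e2 = - e2" "half_turn e1 e3 = - e3"
    using nz by (simp_all add: half_turn_eq coords scaleR_2)
  have pt: "half_turn e1 (pt t s) = pt (- t) (- s)" for t s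
    by (simp add: pt_def linear_add[OF h(1)] linear_scale[OF h(1)] e)
  have "phi (pt (- t) (- s)) e1 = phi (pt t s) e1" "phi (pt (- t) (- s)) e2 = - phi (pt t s) e2"
    "phi (pt (- t) (- s)) e3 = - phi (pt t s) e3" for t s
    using phi_equivariant[OF h(2) pt_nonzero[of t s], of e1]
      phi_equivariant[OF h(2) pt_nonzero[of t s], of e2]
      phi_equivariant[OF h(2) pt_nonzero[of t s], of e3]
    by (simp_all add: pt e phi_neg[OF pt_nonzero])
  from this[of _ 0] this[of 0]
  have odd: "slope2 (- t) = - slope2 t" "slope3 (- t) = - slope3 t" for t
    by (simp_all add: slope2_def slope3_def)
  show "slope2 t = t"
    by (rule symmetric_polarity_trivial(1)[of slope2 slope3]) (erule sym, rule one, rule one, rule odd, rule odd)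
  show "slope3 s = s"
    by (rule symmetric_polarity_trivial(2)[of slope2 slope3]) (erule sym, rule one, rule one, rule odd, rule odd)
qed

section \<open>The inner product and its orthogonality\<close>

definition ip :: "'a \<Rightarrow> 'a \<Rightarrow> real" where
  "ip x y = phi e1 x * phi e1 y + phi e2 x * phi e2 y + phi e3 x * phi e3 y"

lemma ip_simps:
  "ip (x + y) z = ip x z + ip y z" "ip z (x + y) = ip z x + ip z y"
  "ip (x - y) z = ip x z - ip y z" "ip z (x - y) = ip z x - ip z y"
  "ip (c *\<^sub>R x) z = c * ip x z" "ip z (c *\<^sub>R x) = c * ip z x"
  "ip (- x) z = - ip x z" "ip z (- x) = - ip z x"
  by (simp_all add: ip_def coords algebra_simps)

lemma ip_commute: "ip x y = ip y x"
  by (simp add: ip_def mult.commute)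

lemma ip_basis: "ip e1 e1 = 1" "ip e2 e2 = 1" "ip e3 e3 = 1" "ip e1 e2 = 0" "ip e1 e3 = 0" "ip e2 e3 = 0"
  by (simp_all add: ip_def coords)

lemma ip_pos: "x \<noteq> 0 \<Longrightarrow> ip x x > 0"
proof -
  assume "x \<noteq> 0"
  then have "phi e1 x \<noteq> 0 \<or> phi e2 x \<noteq> 0 \<or> phi e3 x \<noteq> 0"
    using expand[of x] by auto
  then show ?thesis unfolding ip_def
    by (metis add_nonneg_pos add_pos_nonneg not_real_square_gt_zero add_nonneg_nonneg zero_le_square)
qed

text \<open>Such an \<open>x\<close> is a multiple of a chart point, whose polar plane is known from
  \<open>slopes_eq_id\<close>.\<close>

lemma phi_eq_0_iff_ip_of_nonzero_coord:
  assumes "phi e1 x \<noteq> 0"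
  shows "phi x y = 0 \<longleftrightarrow> ip x y = 0"
proof -
  define a where "a = phi e1 x"
  define t where "t = phi e2 x / a"
  define s where "s = phi e3 x / a"
  have a: "a \<noteq> 0" using assms by (simp add: a_def)
  have x: "x = a *\<^sub>R pt t s"
    using expand[of x] a by (simp add: pt_def t_def s_def scaleR_add_right flip: a_def)
  have "phi x y = 0 \<longleftrightarrow> phi (pt t s) y = 0"
    using phi_scale_left[OF pt_nonzero a] a by (simp add: x)
  also have "\<dots> \<longleftrightarrow> phi e1 y + t * phi e2 y + s * phi e3 y = 0"
    using phi_pt_e1 by (simp add: phi_pt_slopes[of t s y] slopes_eq_id)
  also have "\<dots> \<longleftrightarrow> ip x y = 0"
    using a by (simp add: x ip_simps) (simp add: ip_def phi_pt)
  finally show ?thesis .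
qed

text \<open>If \<open>x\<close> has no \<open>e1\<close> coordinate, moving \<open>y\<close> along
  \<open>e1\<close> changes neither side. Give \<open>y\<close> first coordinate 1 in this way and
  exchange the arguments by symmetry; the chart then applies.\<close>

lemma phi_eq_0_iff_ip:
  assumes x: "x \<noteq> 0"
  shows "phi x y = 0 \<longleftrightarrow> ip x y = 0"
proof (cases "phi e1 x = 0")
  case True
  define y' where "y' = y + (1 - phi e1 y) *\<^sub>R e1"
  have y1: "phi e1 y' = 1" by (simp add: y'_def coords)
  then have y': "y' \<noteq> 0" by (auto simp: coords)
  have "phi x e1 = 0" using phi_symmetric[OF nz(1) x True] .
  then have "phi x y = phi x y'" by (simp add: y'_def phi_simps[OF x])
  moreover have "phi x y' = 0 \<longleftrightarrow> phi y' x = 0"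
    using phi_symmetric x y' by blast
  moreover have "phi y' x = 0 \<longleftrightarrow> ip y' x = 0"
    using phi_eq_0_iff_ip_of_nonzero_coord[of y'] y1 by simp
  moreover have "ip y' x = ip x y" using True by (simp add: ip_def y'_def coords mult.commute)
  ultimately show ?thesis by simp
qed (rule phi_eq_0_iff_ip_of_nonzero_coord)

section \<open>Rotations as similarities\<close>

lemma rotation_ip_eq_0:
  assumes d: "d \<in> D" and "ip x y = 0"
  shows "ip (d x) (d y) = 0"
proof (cases "x = 0")
  case True
  then have "d x = 0" using linear_0[OF lin[OF d]] by simp
  then show ?thesis by (simp add: ip_def coords)
next
  case False
  then show ?thesis
    using phi_eq_0_iff_ip rotation_nonzero[OF d False] phi_equivariant[OF d False] assms by metis
qed

text \<open>Preserving orthogonality is enough: the images of \<open>e1 + e2\<close> and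
  \<open>e1 - e2\<close> are orthogonal, so those of \<open>e1\<close> and \<open>e2\<close> have
  equal length, and likewise for \<open>e3\<close>.\<close>

lemma rotation_similarity:
  assumes d: "d \<in> D"
  shows "ip (d x) (d x) = ip (d e1) (d e1) * ip x x"
proof -
  interpret linear d using lin[OF d] .
  have 0: "ip (d e1) (d e2) = 0" "ip (d e1) (d e3) = 0" "ip (d e2) (d e3) = 0"
    by (rule rotation_ip_eq_0[OF d], simp add: ip_basis)+
  note 0 = 0 0(1)[unfolded ip_commute[of "d e1"]] 0(2)[unfolded ip_commute[of "d e1"]]
    0(3)[unfolded ip_commute[of "d e2"]]
  have "ip (d (e1 + e2)) (d (e1 - e2)) = 0" "ip (d (e1 + e3)) (d (e1 - e3)) = 0"
    by (rule rotation_ip_eq_0[OF d], simp add: ip_simps ip_basis ip_commute[of e2 e1] ip_commute[of e3 e1])+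
  then have eq: "ip (d e2) (d e2) = ip (d e1) (d e1)" "ip (d e3) (d e3) = ip (d e1) (d e1)"
    using 0 by (simp_all add: add diff ip_simps)
  have "d x = phi e1 x *\<^sub>R d e1 + phi e2 x *\<^sub>R d e2 + phi e3 x *\<^sub>R d e3"
    by (subst expand[of x]) (simp only: add scale)
  then have "ip (d x) (d x) = phi e1 x * phi e1 x * ip (d e1) (d e1)
      + phi e2 x * phi e2 x * ip (d e1) (d e1) + phi e3 x * phi e3 x * ip (d e1) (d e1)"
    by (simp add: ip_simps 0 eq)
  then show ?thesis by (simp add: ip_def[of x x] algebra_simps)
qed

section \<open>The similarity ratio\<close>

lemma half_turn_swaps:
  assumes "ip u u = ip v v" "u + v \<noteq> 0"
  shows "half_turn (u + v) u = v"
proof -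
  \<comment> \<open>In a rhombus the diagonals are orthogonal, so \<open>u\<close> and
    \<open>v\<close> both have coefficient 1/2 along the axis \<open>u + v\<close>.\<close>
  have "ip (u + v) (u - v) = 0" using assms(1) by (simp add: ip_simps ip_commute[of v u])
  then have "phi (u + v) u = phi (u + v) v"
    using phi_eq_0_iff_ip[OF assms(2), of "u - v"] by (simp add: phi_diff[OF assms(2)])
  moreover have "phi (u + v) u + phi (u + v) v = 1"
    using phi_self[OF assms(2)] by (simp add: phi_add[OF assms(2)])
  ultimately show ?thesis using half_turn_eq[OF assms(2), of u] by simp
qed

lemma half_turn_orth:
  assumes "v \<noteq> 0" "ip v x = 0" shows "half_turn v x = - x"
  using assms by (simp add: half_turn_eq phi_eq_0_iff_ip)

lemma li2_e12: "li2 e1 e2"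
proof (rule li2I[OF nz(1)])
  fix c show "e2 \<noteq> c *\<^sub>R e1"
  proof
    assume e2: "e2 = c *\<^sub>R e1"
    have "c = phi e1 (c *\<^sub>R e1)" by (simp add: coords)
    then have "c = 0" using orth(1) by (simp flip: e2)
    then show False using e2 nz by simp
  qed
qed

text \<open>The square of \<open>d\<close> scales \<open>e1\<close> and \<open>e2\<close> by
  \<open>s * s\<close>, so it preserves a flag and is the identity.\<close>

lemma dilation_trivial:
  assumes d: "d \<in> D" and s: "s > 0" and de1: "d e1 = s *\<^sub>R e1 \<or> d e1 = - (s *\<^sub>R e1)"
    and de2: "d e2 = s *\<^sub>R e2 \<or> d e2 = - (s *\<^sub>R e2)"
  shows "s = 1"
proof -
  interpret linear d using lin[OF d] .
  have *: "(d \<circ> d) e1 = (s * s) *\<^sub>R e1" "(d \<circ> d) e2 = 0 *\<^sub>R e1 + (s * s) *\<^sub>R e2"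
    using de1 de2 by (auto simp: scale neg)
  have "d \<circ> d = id"
    by (rule flag_free[OF comp[OF d d] li2_e12 _ _ *]) (use s in auto)
  then have "e1 = (s * s) *\<^sub>R e1" using *(1) by simp
  then have "(s * s - 1) *\<^sub>R e1 = 0" by (simp add: algebra_simps)
  then show ?thesis using nz s by (auto simp: square_eq_1_iff)
qed

text \<open>With \<open>w\<close> the unit vector along \<open>d e2\<close>, the half-turn about
  \<open>w + e2\<close> brings \<open>w\<close> back to \<open>e2\<close> and negates
  \<open>e1\<close>; the composite is covered by \<open>dilation_trivial\<close>. If
  \<open>w = - e2\<close>, then \<open>d\<close> itself is.\<close>

lemma dilation_trivial_of_axis:
  assumes d: "d \<in> D" and s: "s > 0" and de1: "d e1 = s *\<^sub>R e1"
  shows "s = 1"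
proof -
  define w where "w = inverse s *\<^sub>R d e2"
  have de2: "d e2 = s *\<^sub>R w" using s by (simp add: w_def)
  have "ip (d e1) (d e2) = 0" by (rule rotation_ip_eq_0[OF d]) (simp add: ip_basis)
  then have e1w: "ip e1 w = 0" using s by (simp add: de1 de2 ip_simps)
  have "ip (d e2) (d e2) = s * s"
    using rotation_similarity[OF d, of e2] by (simp add: de1 ip_simps ip_basis)
  then have ww: "ip w w = 1" using s by (simp add: de2 ip_simps)
  show ?thesis
  proof (cases "w + e2 = 0")
    case True
    then have "w = - e2" by (simp add: eq_neg_iff_add_eq_0)
    then show ?thesis using dilation_trivial[OF d s] de1 de2 by simp
  next
    case False
    let ?k = "half_turn (w + e2)"
    have k: "?k \<in> D" using half_turn_in[OF False] .
    interpret linear ?k using lin[OF k] .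
    have "?k w = e2" using half_turn_swaps[OF _ False] ww by (simp add: ip_basis)
    moreover have "?k e1 = - e1"
      using half_turn_orth[OF False] e1w by (simp add: ip_simps ip_commute[of _ e1] ip_basis)
    ultimately show ?thesis
      using dilation_trivial[OF comp[OF k d] s] by (simp add: de1 de2 scale)
  qed
qed

text \<open>With \<open>u\<close> the unit vector along \<open>d e1\<close>, a half-turn returns
  \<open>u\<close> to \<open>e1\<close> and keeps the scale factor \<open>s\<close>, so
  \<open>dilation_trivial_of_axis\<close> gives \<open>s = 1\<close>.\<close>

lemma rotation_isometry:
  assumes d: "d \<in> D"
  shows "ip (d x) (d x) = ip x x"
proof -
  define s where "s = sqrt (ip (d e1) (d e1))"
  have "ip (d e1) (d e1) > 0" using ip_pos rotation_nonzero[OF d nz(1)] .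
  then have s: "s > 0" "ip (d e1) (d e1) = s * s" by (simp_all add: s_def)
  define u where "u = inverse s *\<^sub>R d e1"
  have de1: "d e1 = s *\<^sub>R u" using s by (simp add: u_def)
  have uu: "ip u u = 1" using s by (simp add: de1 ip_simps)
  have "s = 1"
  proof (cases "u + e1 = 0")
    \<comment> \<open>The axis \<open>u + e1\<close> degenerates here; the half-turn about
      \<open>e2\<close>, which negates \<open>e1\<close>, takes its place.\<close>
    case True
    then have u: "u = - e1" by (simp add: eq_neg_iff_add_eq_0)
    have k: "half_turn e2 \<in> D" using half_turn_in[OF nz(2)] .
    interpret linear "half_turn e2" using lin[OF k] .
    have "half_turn e2 e1 = - e1"
      by (rule half_turn_orth[OF nz(2)]) (simp add: ip_commute[of e2] ip_basis)
    then show ?thesis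
      using dilation_trivial_of_axis[OF comp[OF k d] s(1)] by (simp add: de1 u scale neg)
  next
    case False
    have k: "half_turn (u + e1) \<in> D" using half_turn_in[OF False] .
    interpret linear "half_turn (u + e1)" using lin[OF k] .
    have "half_turn (u + e1) u = e1" using half_turn_swaps[OF _ False] uu by (simp add: ip_basis)
    then show ?thesis
      using dilation_trivial_of_axis[OF comp[OF k d] s(1)] by (simp add: de1 scale)
  qed
  then show ?thesis using rotation_similarity[OF d, of x] s(2) by simp
qed

lemma orthogonal_wrt_imp_ip:
  assumes "orthogonal_wrt D v w"
  shows "ip v w = 0"
proof -
  have *: "ip x y = 0" if "d \<in> D" "d x = x" "d y = - y" for d x y
  proof (cases "x = 0")
    case False
    then show ?thesis using orthogonal_wrt_imp_phi[OF that] phi_eq_0_iff_ip by blast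
  qed (simp add: ip_def coords)
  show ?thesis
    using assms * ip_commute[of v w] unfolding orthogonal_wrt_def by metis
qed

end

section \<open>Pythagoras' theorem\<close>

theorem mainTheorem2:
  fixes D :: "('a::real_vector \<Rightarrow> 'a) set"
    and v w n :: 'a
    and a b c :: real
  assumes "dim (UNIV :: 'a set) = 3"
    and "rotation_group D"
    and "orthogonal_wrt D v w"
    and "n \<noteq> 0"
    and "\<exists>d\<in>D. d v = a *\<^sub>R n"
    and "\<exists>d\<in>D. d w = b *\<^sub>R n"
    and "\<exists>d\<in>D. d (v + w) = c *\<^sub>R n"
  shows "a\<^sup>2 + b\<^sup>2 = c\<^sup>2"
proof -
  interpret rotations D by (rule rotation_group_imp_rotations[OF assms(1,2)])
  obtain e1 e2 e3 where e: "e1 \<noteq> 0" "e2 \<noteq> 0" "e3 \<noteq> 0" "phi e1 e2 = 0" "phi e1 e3 = 0"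
    "phi e2 e3 = 0" "phi (e1 + e2) (e1 - e2) = 0" "phi (e1 + e3) (e1 - e3) = 0"
    using orthonormal_frame by blast
  interpret frame D e1 e2 e3 by unfold_locales (fact e)+
  \<comment> \<open>Rotations being isometries, the squared length of a vector can be read off from
    any rotation that takes it to a multiple of \<open>n\<close>.\<close>
  have len: "ip x x = k\<^sup>2 * ip n n" if ex: "\<exists>d\<in>D. d x = k *\<^sub>R n" for x k
  proof -
    obtain d where "d \<in> D" "d x = k *\<^sub>R n" using ex by blast
    then show ?thesis
      using rotation_isometry[of d x] by (simp add: ip_simps power2_eq_square)
  qed
  have "ip (v + w) (v + w) = ip v v + ip w w"
    using orthogonal_wrt_imp_ip[OF assms(3)] by (simp add: ip_simps ip_commute[of w v])
  then have "(a\<^sup>2 + b\<^sup>2) * ip n n = c\<^sup>2 * ip n n"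
    using len assms(5-7) by (simp add: distrib_right)
  then show ?thesis using ip_pos[OF assms(4)] by simp
qed

end
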